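(* Let $P=\{x\in\mathbb{R}^n \mid Ax\le b\}$ be a 0-1 polytope, where $A$ is totally unimodular and $b$ is integral. Let $a_i^\top x\le b_i$ be the $i$-th inequality of the system $Ax\le b$, and let $F$ be the face of $P$ defined by $a_i^\top x=b_i$. Then $$\mathrm{forb}(P,\mathrm{vert}(F))=P\cap\{x\in\mathbb{R}^n \mid a_i^\top x\le b_i-1\}.$$
   Context: $\mathrm{vert}(P)$ is the set of vertices of a polytope $P$. Polytopes $P$ are nonempty and rational. A 0-1 polytope is a polytope all of whose vertices lie in $\{0,1\}^n$. For $X\subseteq\mathrm{vert}(P)$, $\mathrm{forb}(P,X):=\mathrm{conv}(\mathrm{vert}(P)\setminus X)$, where $\mathrm{conv}$ denotes convex hull (with $\mathrm{conv}(\varnothing)=\varnothing$). *)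

theory Defs
  imports "Jordan_Normal_Form.Determinant" "HOL-Analysis.Analysis"
begin

no_notation Matrix.vec_index (infixl \<open>$\<close> 100)
no_notation Matrix.scalar_prod (infix \<open>\<bullet>\<close> 70)
hide_const (open) Matrix.row Determinant.det Matrix.mat Matrix.vec

(* The k-by-k submatrices of A are listed by injective selections r, c of their rows and
   columns. Reordering these changes a minor only by its sign, so admitting all
   orderings is harmless. *)
definition totally_unimodular :: "real ^ 'n ^ 'm \<Rightarrow> bool" where
  "totally_unimodular A \<longleftrightarrow>
    (\<forall>k (r :: nat \<Rightarrow> 'm) (c :: nat \<Rightarrow> 'n).
      inj_on r {..<k} \<longrightarrow> inj_on c {..<k} \<longrightarrow>
      Determinant.det (Matrix.mat k k (\<lambda>(p, q). A $ r p $ c q)) \<in> {-1, 0, 1})"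

definition vert :: "(real ^ 'n) set \<Rightarrow> (real ^ 'n) set" where
  "vert P = {v. v extreme_point_of P}"

(* Polytopes are nonempty by convention, which the library predicate does not require.
   Rationality needs no clause of its own: the vertices are 0-1 vectors. *)
definition zero_one_polytope :: "(real ^ 'n) set \<Rightarrow> bool" where
  "zero_one_polytope P \<longleftrightarrow>
    polytope P \<and> P \<noteq> {} \<and> (\<forall>v \<in> vert P. \<forall>j. v $ j \<in> {0, 1})"

definition forb :: "(real ^ 'n) set \<Rightarrow> (real ^ 'n) set \<Rightarrow> (real ^ 'n) set" where
  "forb P X = convex hull (vert P - X)"

end

theory Submission
  imports Defs
begin

text \<open>
  Since \<open>b\<close> is integral, replacing \<open>b\<^sub>i\<close> by \<open>b\<^sub>i - 1\<close> keeps the right-hand side integral, so by the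
  Hoffman--Kruskal argument (tight rows at an extreme point contain a nonsingular, hence
  unimodular, subsystem) all vertices of \<open>P \<inter> {x. a\<^sub>i\<^sup>T x \<le> b\<^sub>i - 1}\<close> are integral. Being integral
  points of the cube, they are vertices of \<open>P\<close>, and they miss \<open>F\<close>. Conversely a vertex of \<open>P\<close> off
  \<open>F\<close> satisfies \<open>a\<^sub>i\<^sup>T v < b\<^sub>i\<close> with both sides integers.
\<close>

section \<open>Integrality for integral and unimodular matrices\<close>

lemma det_Ints:
  fixes M :: "'a :: comm_ring_1 Matrix.mat"
  assumes "M \<in> carrier_mat n n" and "\<And>p q. p < n \<Longrightarrow> q < n \<Longrightarrow> M $$ (p, q) \<in> \<int>"
  shows "Determinant.det M \<in> \<int>"
  unfolding det_def'[OF assms(1)]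
proof (intro Ints_sum Ints_mult Ints_prod)
  fix \<pi> assume "\<pi> \<in> {\<pi>. \<pi> permutes {0..<n}}"
  then have \<pi>: "\<pi> permutes {0..<n}" by simp
  show "signof \<pi> \<in> (\<int> :: 'a set)" by (simp add: sign_def)
  fix p assume p: "p \<in> {0..<n}"
  then have "\<pi> p < n" using permutes_in_image[OF \<pi>] by auto
  then show "M $$ (p, \<pi> p) \<in> \<int>" using assms(2) p by auto
qed

lemma adj_mat_Ints:
  fixes M :: "'a :: comm_ring_1 Matrix.mat"
  assumes M: "M \<in> carrier_mat n n" and ints: "\<And>p q. p < n \<Longrightarrow> q < n \<Longrightarrow> M $$ (p, q) \<in> \<int>"
    and pq: "p < n" "q < n"
  shows "adj_mat M $$ (p, q) \<in> \<int>"
proof -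
  have "mat_delete M q p \<in> carrier_mat (n - 1) (n - 1)"
    using M by (rule mat_delete_carrier)
  moreover have "mat_delete M q p $$ (s, t) \<in> \<int>" if "s < n - 1" "t < n - 1" for s t
    using that M pq by (auto simp: mat_delete_def intro!: ints)
  ultimately have "Determinant.det (mat_delete M q p) \<in> \<int>" by (rule det_Ints)
  then show ?thesis
    using M pq by (auto simp: adj_mat_def cofactor_def intro!: Ints_mult Ints_power)
qed

text \<open>Cramer's rule in adjugate form: \<open>adj_mat M * M\<close> is \<open>det M\<close>
  times the identity, so applying the integral matrix \<open>adj_mat M\<close> to the integral
  vector \<open>M *\<^sub>v x\<close> gives \<open>det M\<close> times \<open>x\<close>. A
  determinant of 1 or -1 can then be cancelled within the integers.\<close>

lemma unimodular_solution_Ints: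
  fixes M :: "'a :: comm_ring_1 Matrix.mat"
  assumes M: "M \<in> carrier_mat n n" and ints: "\<And>p q. p < n \<Longrightarrow> q < n \<Longrightarrow> M $$ (p, q) \<in> \<int>"
    and det: "Determinant.det M \<in> {-1, 1}"
    and x: "x \<in> carrier_vec n"
    and rhs: "\<And>p. p < n \<Longrightarrow> vec_index (M *\<^sub>v x) p \<in> \<int>"
    and q: "q < n"
  shows "vec_index x q \<in> \<int>"
proof -
  have adj: "adj_mat M \<in> carrier_mat n n" using adj_mat(1)[OF M] .
  have "adj_mat M *\<^sub>v (M *\<^sub>v x) = (adj_mat M * M) *\<^sub>v x"
    using assoc_mult_mat_vec[OF adj M x] by simp
  also have "\<dots> = Determinant.det M \<cdot>\<^sub>v x"
  proof (rule eq_vecI)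
    fix p assume "p < dim_vec (Determinant.det M \<cdot>\<^sub>v x)"
    then have p: "p < n" using x by simp
    have "vec_index ((adj_mat M * M) *\<^sub>v x) p = scalar_prod (Determinant.det M \<cdot>\<^sub>v unit_vec n p) x"
      using p x by (simp add: adj_mat(3)[OF M])
    also have "\<dots> = Determinant.det M * vec_index x p"
      using p x by (simp add: smult_scalar_prod_distrib[of _ n] scalar_prod_left_unit[of _ n])
    finally show "vec_index ((adj_mat M * M) *\<^sub>v x) p = vec_index (Determinant.det M \<cdot>\<^sub>v x) p"
      using p x by simp
  qed (use adj M x in simp)
  finally have "Determinant.det M * vec_index x q = vec_index (adj_mat M *\<^sub>v (M *\<^sub>v x)) q"
    using x q by simp
  also have "\<dots> \<in> \<int>"
    using adj M q
    by (auto simp: scalar_prod_def simp del: index_mult_mat_vec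
        simp: index_mult_mat_vec[of q "adj_mat M"]
        intro!: Ints_sum Ints_mult adj_mat_Ints[OF M ints] rhs)
  finally show ?thesis using det by auto
qed

text \<open>Entries are minors of order 1.\<close>

lemma totally_unimodular_entry_Ints:
  assumes "totally_unimodular A"
  shows "A $ j $ l \<in> \<int>"
proof -
  have "inj_on (\<lambda>_::nat. j) {..<1}" "inj_on (\<lambda>_::nat. l) {..<1}"
    by (auto simp: inj_on_def)
  then have "Determinant.det (Matrix.mat 1 1 (\<lambda>(p, q). A $ j $ l)) \<in> {-1, 0, 1}"
    using assms unfolding totally_unimodular_def by blast
  moreover have "Determinant.det (Matrix.mat 1 1 (\<lambda>(p, q). A $ j $ l)) = A $ j $ l"
    by (subst det_single) auto
  ultimately show ?thesis by auto
qed

section \<open>Extreme points of polyhedra and their tight rows\<close>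

lemma matrix_vector_mult_le_iff:
  fixes A :: "real ^ 'n ^ 'm"
  shows "A *v x \<le> b \<longleftrightarrow> (\<forall>j. row j A \<bullet> x \<le> b $ j)"
  by (simp add: less_eq_vec_def matrix_vector_mul_component row_def)

text \<open>Otherwise some nonzero \<open>d\<close> is orthogonal to every tight row. Small moves
  from \<open>v\<close> along \<open>d\<close> and \<open>-d\<close> then keep tight rows tight and
  respect the slack ones, so \<open>v\<close> would be the midpoint of two distinct feasible
  points.\<close>

lemma span_tight_rows_extreme_point:
  fixes A :: "real ^ 'n ^ 'm"
  assumes "v extreme_point_of {x. A *v x \<le> b}"
  shows "span ((\<lambda>j. row j A) ` {j. row j A \<bullet> v = b $ j}) = UNIV"
proof (rule ccontr)
  define T where "T = {j. row j A \<bullet> v = b $ j}"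
  assume "\<not> ?thesis"
  then obtain d where d: "d \<noteq> 0" and orth: "\<forall>x \<in> span ((\<lambda>j. row j A) ` T). d \<bullet> x = 0"
    unfolding T_def using span_not_UNIV_orthogonal by blast
  have dT: "row j A \<bullet> d = 0" if "j \<in> T" for j
    using orth that by (metis image_eqI inner_commute span_base)
  have v: "row j A \<bullet> v \<le> b $ j" for j
    using assms by (auto simp: extreme_point_of_def matrix_vector_mult_le_iff)
  have slack: "0 < b $ j - row j A \<bullet> v" if "j \<notin> T" for j
    using v[of j] that by (auto simp: T_def)
  \<comment> \<open>A step length that no slack row forbids. The \<open>+ 1\<close> avoids a zero
    denominator when \<open>d\<close> is orthogonal to a slack row, and \<open>insert 1\<close>
    keeps the set nonempty when every row is tight.\<close>
  define \<epsilon> where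
    "\<epsilon> = Min (insert 1 ((\<lambda>j. (b $ j - row j A \<bullet> v) / (\<bar>row j A \<bullet> d\<bar> + 1)) ` (- T)))"
  have pos: "0 < \<epsilon>"
    unfolding \<epsilon>_def by (subst Min_gr_iff) (auto intro!: divide_pos_pos slack)
  have step: "\<bar>\<epsilon> * (row j A \<bullet> d)\<bar> \<le> b $ j - row j A \<bullet> v" for j
  proof (cases "j \<in> T")
    case True
    then show ?thesis using dT v[of j] by simp
  next
    case False
    then have "\<epsilon> \<le> (b $ j - row j A \<bullet> v) / (\<bar>row j A \<bullet> d\<bar> + 1)"
      unfolding \<epsilon>_def by (intro Min_le) auto
    then have "\<epsilon> * (\<bar>row j A \<bullet> d\<bar> + 1) \<le> b $ j - row j A \<bullet> v"
      by (subst (asm) pos_le_divide_eq) auto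
    then show ?thesis using pos by (simp add: abs_mult algebra_simps)
  qed
  have "v + \<epsilon> *\<^sub>R d \<in> {x. A *v x \<le> b}" "v - \<epsilon> *\<^sub>R d \<in> {x. A *v x \<le> b}"
    using abs_le_D1[OF step] abs_le_D2[OF step]
    by (simp_all add: matrix_vector_mult_le_iff inner_right_distrib inner_diff_right algebra_simps)
  moreover have "v \<in> open_segment (v + \<epsilon> *\<^sub>R d) (v - \<epsilon> *\<^sub>R d)"
  proof -
    have "midpoint (v + \<epsilon> *\<^sub>R d) (v - \<epsilon> *\<^sub>R d) = v"
      by (simp add: midpoint_def scaleR_2[symmetric])
    moreover have "v + \<epsilon> *\<^sub>R d \<noteq> v - \<epsilon> *\<^sub>R d"
    proof
      assume "v + \<epsilon> *\<^sub>R d = v - \<epsilon> *\<^sub>R d"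
      then have "(2 * \<epsilon>) *\<^sub>R d = 0" by (simp add: algebra_simps scaleR_2[symmetric])
      then show False using pos d by simp
    qed
    ultimately show ?thesis by (metis midpoint_in_open_segment)
  qed
  ultimately show False using assms by (auto simp: extreme_point_of_def)
qed

lemma totally_unimodular_extreme_point_Ints:
  fixes A :: "real ^ 'n ^ 'm"
  assumes TU: "totally_unimodular A" and b: "\<forall>j. b $ j \<in> \<int>"
    and ext: "v extreme_point_of {x. A *v x \<le> b}"
  shows "v $ l \<in> \<int>"
proof -
  define T where "T = {j. row j A \<bullet> v = b $ j}"
  define n where "n = CARD('n)"
  obtain B where B: "B \<subseteq> (\<lambda>j. row j A) ` T" "independent B"
      "(\<lambda>j. row j A) ` T \<subseteq> span B" "card B = dim ((\<lambda>j. row j A) ` T)"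
    using basis_exists by blast
  have spanT: "span ((\<lambda>j. row j A) ` T) = UNIV"
    using span_tight_rows_extreme_point[OF ext] by (simp add: T_def)
  then have spanB: "span B = UNIV"
    by (metis B(3) span_minimal subspace_span top.extremum_uniqueI)
  have "card B = n"
    using B(4) spanT by (metis dim_span dim_UNIV DIM_cart DIM_real n_def nat_mult_1_right)
  then obtain h where h: "bij_betw h {..<n} B"
    using ex_bij_betw_nat_finite[of B] independent_imp_finite[OF B(2)]
    by (auto simp: atLeast0LessThan)
  \<comment> \<open>The basis \<open>B\<close> consists of vectors, whereas minors are selected by
    row indices, and equal rows may occur at several indices. One tight index is chosen per basis
    vector; \<open>r\<close> inherits injectivity from \<open>h\<close>.\<close>
  define r where "r p = (SOME j. j \<in> T \<and> row j A = h p)" for p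
  have r: "r p \<in> T \<and> row (r p) A = h p" if "p < n" for p
  proof -
    have "h p \<in> B" using h that by (auto simp: bij_betw_def)
    then have "h p \<in> (\<lambda>j. row j A) ` T" using B(1) by (rule rev_subsetD)
    then obtain j where "h p = row j A" "j \<in> T" by (rule imageE)
    then have "\<exists>j. j \<in> T \<and> row j A = h p" by metis
    then show ?thesis unfolding r_def by (rule someI_ex)
  qed
  have r_inj: "inj_on r {..<n}"
    by (rule inj_onI) (metis bij_betw_imp_inj_on h inj_onD lessThan_iff r)
  obtain c :: "nat \<Rightarrow> 'n" where c: "bij_betw c {..<n} UNIV"
    using ex_bij_betw_nat_finite[of "UNIV :: 'n set"] by (auto simp: n_def atLeast0LessThan)
  define M where "M = Matrix.mat n n (\<lambda>(p, q). A $ r p $ c q)"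
  have M: "M \<in> carrier_mat n n" by (simp add: M_def)
  have M_mult: "vec_index (M *\<^sub>v Matrix.vec n (\<lambda>q. x $ c q)) p = row (r p) A \<bullet> x"
    if "p < n" for p x
  proof -
    have "vec_index (M *\<^sub>v Matrix.vec n (\<lambda>q. x $ c q)) p = (\<Sum>q<n. A $ r p $ c q * x $ c q)"
      using that by (simp add: M_def scalar_prod_def atLeast0LessThan)
    also have "\<dots> = (\<Sum>l\<in>UNIV. A $ r p $ l * x $ l)"
      by (rule sum.reindex_bij_betw[OF c])
    finally show ?thesis by (simp add: inner_vec_def row_def)
  qed
  \<comment> \<open>A kernel vector of \<open>M\<close>, carried back along \<open>c\<close> to a
    vector \<open>d\<close>, is orthogonal to all of \<open>B\<close>. Since \<open>B\<close> spans
    the space, \<open>d\<close> is orthogonal to itself and vanishes.\<close>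
  have "Determinant.det M \<noteq> 0"
  proof
    assume "Determinant.det M = 0"
    then obtain w where w: "w \<in> carrier_vec n" "w \<noteq> 0\<^sub>v n" "M *\<^sub>v w = 0\<^sub>v n"
      using det_0_iff_vec_prod_zero_field[OF M] by auto
    define d :: "real ^ 'n" where "d = (\<chi> l. vec_index w (inv_into {..<n} c l))"
    have dc: "d $ c q = vec_index w q" if "q < n" for q
      using that c by (simp add: d_def bij_betw_inv_into_left)
    have wd: "w = Matrix.vec n (\<lambda>q. d $ c q)"
      using w(1) by (auto simp: dc)
    have "d \<bullet> x = 0" if x: "x \<in> B" for x
    proof -
      obtain p where "p < n" "x = h p" using h x by (auto simp: bij_betw_def)
      then show ?thesis
        using M_mult[of p d] w(3) r[of p] by (simp add: wd[symmetric] inner_commute)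
    qed
    then have "d \<in> span B \<Longrightarrow> d \<bullet> d = 0"
      using orthogonal_to_span[of d B d] by (auto simp: orthogonal_def)
    then have "d = 0" by (simp add: spanB)
    then have "w = 0\<^sub>v n" using wd by auto
    with w(2) show False ..
  qed
  moreover have "Determinant.det M \<in> {-1, 0, 1}"
    using TU r_inj bij_betw_imp_inj_on[OF c] unfolding totally_unimodular_def M_def by blast
  ultimately have det: "Determinant.det M \<in> {-1, 1}" by auto
  obtain q where q: "q < n" "l = c q"
    using c by (metis UNIV_I bij_betw_imp_surj_on imageE lessThan_iff)
  \<comment> \<open>The chosen rows are tight at \<open>v\<close>, so \<open>M\<close> maps the
    reindexed \<open>v\<close> to entries of \<open>b\<close>.\<close>
  have "vec_index (Matrix.vec n (\<lambda>q. v $ c q)) q \<in> \<int>"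
  proof (rule unimodular_solution_Ints[OF M _ det _ _ q(1)])
    show "M $$ (p, q) \<in> \<int>" if "p < n" "q < n" for p q
      using that by (simp add: M_def totally_unimodular_entry_Ints[OF TU])
    show "vec_index (M *\<^sub>v Matrix.vec n (\<lambda>q. v $ c q)) p \<in> \<int>" if "p < n" for p
    proof -
      have "row (r p) A \<bullet> v = b $ r p" using r[OF that] unfolding T_def by blast
      then show ?thesis using b by (simp only: M_mult[OF that])
    qed
  qed simp
  then show ?thesis using q by simp
qed

section \<open>0-1 polytopes and their integral points\<close>

lemma zero_one_polytope_convex_hull_vert:
  assumes "zero_one_polytope P"
  shows "P = convex hull (vert P)"
proof -
  have "polytope P" using assms by (simp add: zero_one_polytope_def)
  then show ?thesis
    unfolding vert_def
    by (intro Krein_Milman_Minkowski polytope_imp_compact polytope_imp_convex)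
qed

lemma zero_one_polytope_bounds:
  assumes "zero_one_polytope P" "x \<in> P"
  shows "0 \<le> x $ l \<and> x $ l \<le> 1"
proof -
  have "convex ((\<lambda>x :: real ^ 'a. x $ l) -` {0..1})"
    by (intro convex_linear_vimage bounded_linear.linear bounded_linear_vec_nth) simp
  then have "convex {x :: real ^ 'a. 0 \<le> x $ l \<and> x $ l \<le> 1}"
    by (simp add: vimage_def)
  moreover have "vert P \<subseteq> {x. 0 \<le> x $ l \<and> x $ l \<le> 1}"
  proof
    fix v assume "v \<in> vert P"
    then have "v $ l \<in> {0, 1}" using assms(1) by (simp add: zero_one_polytope_def)
    then show "v \<in> {x. 0 \<le> x $ l \<and> x $ l \<le> 1}" by auto
  qed
  ultimately have "convex hull (vert P) \<subseteq> {x. 0 \<le> x $ l \<and> x $ l \<le> 1}"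
    by (rule hull_minimal[rotated])
  then show ?thesis using assms zero_one_polytope_convex_hull_vert by blast
qed

text \<open>\<open>P\<close> lies in the unit cube, so each coordinate of \<open>v\<close> is 0 or
  1, an extreme value of that coordinate over the cube. A convex combination with two positive
  weights attains such a value only if both endpoints do; hence the endpoints of a segment through
  \<open>v\<close> coincide.\<close>

lemma Ints_point_in_vert:
  assumes P: "zero_one_polytope P" and v: "v \<in> P" "\<And>l. v $ l \<in> \<int>"
  shows "v \<in> vert P"
proof -
  have v01: "v $ l = 0 \<or> v $ l = 1" for l
    using zero_one_polytope_bounds[OF P v(1), of l] v(2)[of l] by (auto elim!: Ints_cases)
  have "v \<notin> open_segment x y" if xy: "x \<in> P" "y \<in> P" for x y
  proof
    assume "v \<in> open_segment x y"
    then obtain u where u: "x \<noteq> y" "0 < u" "u < 1" "v = (1 - u) *\<^sub>R x + u *\<^sub>R y"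
      by (auto simp: in_segment)
    have "x $ l = y $ l" for l
    proof -
      have eq: "v $ l = (1 - u) * x $ l + u * y $ l" using u(4) by simp
      have bx: "0 \<le> x $ l" "x $ l \<le> 1" and by': "0 \<le> y $ l" "y $ l \<le> 1"
        using zero_one_polytope_bounds[OF P] xy by auto
      from v01[of l] show ?thesis
      proof
        assume "v $ l = 0"
        then have "(1 - u) * x $ l = 0 \<and> u * y $ l = 0"
          using eq u bx by' by (simp add: add_nonneg_eq_0_iff)
        then show ?thesis using u by auto
      next
        assume "v $ l = 1"
        \<comment> \<open>Passing to the distances from 1 again gives a vanishing sum of nonnegative
          terms.\<close>
        then have "(1 - u) * (1 - x $ l) + u * (1 - y $ l) = 0"
          using eq by (simp add: algebra_simps)
        then have "(1 - u) * (1 - x $ l) = 0 \<and> u * (1 - y $ l) = 0"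
          using u bx by' by (simp add: add_nonneg_eq_0_iff)
        then show ?thesis using u by auto
      qed
    qed
    then show False using u(1) by (simp add: vec_eq_iff)
  qed
  then show ?thesis using v(1) by (auto simp: vert_def extreme_point_of_def)
qed

theorem proposition19:
  fixes A :: "real ^ 'n ^ 'm" and b :: "real ^ 'm" and i :: 'm
    and P F :: "(real ^ 'n) set"
  assumes P_eq: "P = {x. A *v x \<le> b}"
    and P01: "zero_one_polytope P"
    and TU: "totally_unimodular A"
    and b_int: "\<forall>j. b $ j \<in> \<int>"
    and F_eq: "F = P \<inter> {x. row i A \<bullet> x = b $ i}"
  shows "forb P (vert F) = P \<inter> {x. row i A \<bullet> x \<le> b $ i - 1}"
proof
  define H where "H = {x. row i A \<bullet> x \<le> b $ i - 1}"
  have poly: "polytope P" using P01 by (simp add: zero_one_polytope_def)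
  have convH: "convex H" unfolding H_def by (rule convex_halfspace_le)
  have "vert P - vert F \<subseteq> P \<inter> H"
  proof
    fix v assume v: "v \<in> vert P - vert F"
    then have vP: "v \<in> P" by (auto simp: vert_def extreme_point_of_def)
    \<comment> \<open>An extreme point of \<open>P\<close> that lies in the subset \<open>F\<close>
      is extreme in \<open>F\<close> too, so being outside \<open>vert F\<close> means being outside
      \<open>F\<close>.\<close>
    have "v \<notin> F"
      using v by (auto simp: vert_def extreme_point_of_def F_eq)
    then have less: "row i A \<bullet> v < b $ i"
      using vP by (auto simp: F_eq P_eq matrix_vector_mult_le_iff less_le)
    have v_int: "v $ l \<in> \<int>" for l
    proof -
      have "v $ l \<in> {0, 1}" using P01 v by (simp add: zero_one_polytope_def)
      then show ?thesis by auto
    qed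
    have "row i A \<bullet> v \<in> \<int>"
      using v_int totally_unimodular_entry_Ints[OF TU]
      by (auto simp: inner_vec_def row_def intro!: Ints_sum Ints_mult)
    then obtain k :: int where k: "row i A \<bullet> v = of_int k" by (auto elim: Ints_cases)
    obtain m :: int where m: "b $ i = of_int m" using b_int by (metis Ints_cases)
    have "k \<le> m - 1" using less k m by simp
    then have "row i A \<bullet> v \<le> b $ i - 1" using k m by linarith
    then show "v \<in> P \<inter> H" using vP by (simp add: H_def)
  qed
  then show "forb P (vert F) \<subseteq> P \<inter> {x. row i A \<bullet> x \<le> b $ i - 1}"
    unfolding forb_def H_def[symmetric]
    by (intro hull_minimal convex_Int polytope_imp_convex[OF poly] convH)
  \<comment> \<open>Row \<open>i\<close> is tightened in place rather than appended as a new row, so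
    the matrix stays \<open>A\<close> and its total unimodularity applies directly.\<close>
  define b' where "b' = (\<chi> j. if j = i then b $ j - 1 else b $ j)"
  have Q_eq: "P \<inter> H = {x. A *v x \<le> b'}"
  proof (intro equalityI subsetI)
    fix x assume x: "x \<in> {x. A *v x \<le> b'}"
    then have le: "row j A \<bullet> x \<le> b' $ j" for j by (simp add: matrix_vector_mult_le_iff)
    have "row j A \<bullet> x \<le> b $ j" for j
      using le[of j] by (simp add: b'_def split: if_splits)
    then have "x \<in> P" by (simp add: P_eq matrix_vector_mult_le_iff)
    moreover have "x \<in> H" using le[of i] by (simp add: H_def b'_def)
    ultimately show "x \<in> P \<inter> H" by simp
  qed (simp add: P_eq H_def b'_def matrix_vector_mult_le_iff)
  have "{x. x extreme_point_of (P \<inter> H)} \<subseteq> vert P - vert F"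
  proof
    fix v assume "v \<in> {x. x extreme_point_of (P \<inter> H)}"
    then have ext: "v extreme_point_of (P \<inter> H)" by simp
    then have vPH: "v \<in> P" "v \<in> H" by (auto simp: extreme_point_of_def)
    have "v $ l \<in> \<int>" for l
    proof (rule totally_unimodular_extreme_point_Ints[OF TU])
      show "\<forall>j. b' $ j \<in> \<int>" using b_int by (simp add: b'_def)
    qed (use ext Q_eq in simp)
    then have "v \<in> vert P" by (rule Ints_point_in_vert[OF P01 vPH(1)])
    moreover have "v \<notin> vert F"
      using vPH(2) by (auto simp: vert_def extreme_point_of_def F_eq H_def)
    ultimately show "v \<in> vert P - vert F" by simp
  qed
  \<comment> \<open>Compactness gives enough extreme points. If \<open>P \<inter> H\<close> is
    empty, both sides are empty.\<close>
  moreover have "P \<inter> H = convex hull {x. x extreme_point_of (P \<inter> H)}"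
    unfolding H_def
    by (intro Krein_Milman_Minkowski compact_Int_closed convex_Int closed_halfspace_le
        convex_halfspace_le polytope_imp_compact[OF poly] polytope_imp_convex[OF poly])
  ultimately show "P \<inter> {x. row i A \<bullet> x \<le> b $ i - 1} \<subseteq> forb P (vert F)"
    unfolding forb_def H_def[symmetric] by (metis hull_mono)
qed

end
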